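(* Let $B$ be a set of forbidden permutation patterns and let $\pi$ be a permutation (a downfix). If $\pi$ is ES-reducible with respect to $B$, then $\pi$ is also FS-reducible with respect to $B$.
   Context: A permutation of length $n$ is a reordering $\sigma=\sigma_1\cdots\sigma_n$ of $\{1,\dots,n\}$. The reduction of a string of distinct numbers is the permutation of the same length whose entries are in the same relative order. $\sigma$ contains a pattern $p$ (a permutation of length $k$) if some $\sigma_{i_1}\cdots\sigma_{i_k}$ with $i_1<\dots<i_k$ reduces to $p$; otherwise $\sigma$ avoids $p$. Downfixes and gap vectors: for $0\le l\le n$, the downfix of length $l$ of $\sigma$ is the subsequence $\sigma_{i_1}\cdots\sigma_{i_l}$ ($i_1<\dots<i_l$) consisting of the entries with values in $\{1,\dots,l\}$, in the order in which they occur in $\sigma$ (it is a permutation of length $l$). The corresponding gap vector is $[i_1-1,\,i_2-i_1-1,\,\dots,\,i_l-i_{l-1}-1,\,n-i_l]$, a vector of $l+1$ nonnegative integers with sum $n-l$ (for $l=0$ it is $[n]$). For vectors $\mathbf g,\mathbf h$ of nonnegative integers of the same length, $\mathbf g\succeq\mathbf h$ ("$\mathbf g$ satisfies the gap condition $\mathbf h$") means $g_i\ge h_i$ for all $i$. For a permutation $\pi$ and $\mathbf g\in\mathbb{N}^{|\pi|+1}$ (where $\mathbb N=\{0,1,2,\dots\}$ and $|\pi|$ is the length of $\pi$), $Z(B,\pi,\mathbf g)$ is the set of permutations of length $|\pi|+\sum_i g_i$ that avoid every pattern in $B$, whose downfix of length $|\pi|$ is $\pi$, and whose corresponding gap vector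 is $\mathbf g$. Deletion: for $1\le i\le k$, $d_i(\pi_1\cdots\pi_k)$ is the reduction of $\pi_1\cdots\pi_{i-1}\pi_{i+1}\cdots\pi_k$, and $d_i([g_1,\dots,g_{k+1}])=[g_1,\dots,g_{i-1},g_i+g_{i+1},g_{i+2},\dots,g_{k+1}]$. $\pi$ is ES-reducible (with respect to $B$) if there exists $r\in\{1,\dots,|\pi|\}$ such that for all $\mathbf g\in\mathbb N^{|\pi|+1}$ either $|Z(B,\pi,\mathbf g)|=0$ or $|Z(B,\pi,\mathbf g)|=|Z(B,d_r(\pi),d_r(\mathbf g))|$. $\pi$ is FS-reducible (with respect to $B$) if there exist a finite list $\mathbf{h_1},\dots,\mathbf{h_k}\in\mathbb N^{|\pi|+1}$ with $\mathbf{h_k}=[0,\dots,0]$ and integers $r_1,\dots,r_k\in\{0,1,\dots,|\pi|\}$ such that for all $\mathbf g\in\mathbb N^{|\pi|+1}$, if $i$ is minimal with $\mathbf g\succeq\mathbf{h_i}$, then $|Z(B,\pi,\mathbf g)|=0$ if $r_i=0$, and $|Z(B,\pi,\mathbf g)|=|Z(B,d_{r_i}(\pi),d_{r_i}(\mathbf g))|$ if $r_i\neq 0$. *)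

theory Defs
  imports Main "HOL-Library.Sublist" "HOL-Combinatorics.Multiset_Permutations"
begin

text \<open>Permutations are in one-line notation, so a permutation of length \<open>n\<close> is an element of
  \<^term>\<open>permutations_of_set {1..n::nat}\<close>. Indices in the definitions below are 1-based, list
  access is 0-based.\<close>

definition is_permutation :: "nat list \<Rightarrow> bool" where
  "is_permutation \<sigma> \<longleftrightarrow> \<sigma> \<in> permutations_of_set {1..length \<sigma>}"

definition reduction :: "nat list \<Rightarrow> nat list" where
  "reduction xs = map (\<lambda>x. card {y \<in> set xs. y \<le> x}) xs"

definition pattern_contains :: "nat list \<Rightarrow> nat list \<Rightarrow> bool" where
  "pattern_contains \<sigma> p \<longleftrightarrow> (\<exists>xs. subseq xs \<sigma> \<and> reduction xs = p)"

definition pattern_avoids :: "nat list \<Rightarrow> nat list \<Rightarrow> bool" where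
  "pattern_avoids \<sigma> p \<longleftrightarrow> \<not> pattern_contains \<sigma> p"

definition downfix :: "nat \<Rightarrow> nat list \<Rightarrow> nat list" where
  "downfix l \<sigma> = filter (\<lambda>x. x \<in> {1..l}) \<sigma>"

definition downfix_positions :: "nat \<Rightarrow> nat list \<Rightarrow> nat list" where
  "downfix_positions l \<sigma> = filter (\<lambda>i. \<sigma> ! (i - 1) \<in> {1..l}) [1..<length \<sigma> + 1]"

text \<open>With sentinels \<open>i\<^sub>0 = 0\<close> and \<open>i\<^bsub>l+1\<^esub> = n + 1\<close> every entry of the gap vector is
  \<open>i\<^bsub>j+1\<^esub> - i\<^sub>j - 1\<close>; the positions are strictly increasing, so the subtraction never truncates.\<close>

definition gap_vector :: "nat \<Rightarrow> nat list \<Rightarrow> nat list" where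
  "gap_vector l \<sigma> =
     map2 (\<lambda>a b. b - a - 1)
       (0 # downfix_positions l \<sigma>) (downfix_positions l \<sigma> @ [length \<sigma> + 1])"

definition satisfies_gap :: "nat list \<Rightarrow> nat list \<Rightarrow> bool"  (infix "\<succeq>\<^sub>g" 50) where
  "g \<succeq>\<^sub>g h \<longleftrightarrow> list_all2 (\<ge>) g h"

definition Z :: "nat list set \<Rightarrow> nat list \<Rightarrow> nat list \<Rightarrow> nat list set" where
  "Z B \<pi> g =
     {\<sigma> \<in> permutations_of_set {1..length \<pi> + sum_list g}.
        (\<forall>p\<in>B. pattern_avoids \<sigma> p) \<and> downfix (length \<pi>) \<sigma> = \<pi> \<and> gap_vector (length \<pi>) \<sigma> = g}"

definition del_perm :: "nat \<Rightarrow> nat list \<Rightarrow> nat list" where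
  "del_perm i \<pi> = reduction (take (i - 1) \<pi> @ drop i \<pi>)"

definition del_gap :: "nat \<Rightarrow> nat list \<Rightarrow> nat list" where
  "del_gap i g = take (i - 1) g @ [g ! (i - 1) + g ! i] @ drop (i + 1) g"

definition ES_reducible :: "nat list set \<Rightarrow> nat list \<Rightarrow> bool" where
  "ES_reducible B \<pi> \<longleftrightarrow>
     (\<exists>r\<in>{1..length \<pi>}. \<forall>g. length g = length \<pi> + 1 \<longrightarrow>
        card (Z B \<pi> g) = 0 \<or> card (Z B \<pi> g) = card (Z B (del_perm r \<pi>) (del_gap r g)))"

definition FS_reducible :: "nat list set \<Rightarrow> nat list \<Rightarrow> bool" where
  "FS_reducible B \<pi> \<longleftrightarrow>
     (\<exists>hs rs. hs \<noteq> [] \<and> length rs = length hs \<and>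
        (\<forall>h\<in>set hs. length h = length \<pi> + 1) \<and> last hs = replicate (length \<pi> + 1) 0 \<and>
        set rs \<subseteq> {0..length \<pi>} \<and>
        (\<forall>g i. length g = length \<pi> + 1 \<longrightarrow>
           i < length hs \<longrightarrow> g \<succeq>\<^sub>g hs ! i \<longrightarrow> (\<forall>j<i. \<not> g \<succeq>\<^sub>g hs ! j) \<longrightarrow>
           card (Z B \<pi> g) =
             (if rs ! i = 0 then 0 else card (Z B (del_perm (rs ! i) \<pi>) (del_gap (rs ! i) g)))))"

end

theory Submission
  imports Defs
begin

text \<open>Shrinking gaps keeps \<^term>\<open>Z B \<pi> g\<close> nonempty: delete surplus entries from the gaps and
  reduce. Hence the gap vectors with \<^term>\<open>Z B \<pi> g = {}\<close> form an upward closed set, which by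
  Dickson's lemma is generated by finitely many vectors. List these with \<open>r\<^sub>i = 0\<close>, and append the
  zero vector with the index \<open>r\<close> witnessing ES-reducibility.\<close>

section \<open>Dickson's lemma\<close>

text \<open>Induction on the length. Finitely many vectors of \<open>A\<close> have tails generating
  all tails of \<open>A\<close>; if their heads are at most \<open>M\<close>, they also cover every
  vector of \<open>A\<close> with head at least \<open>M\<close>. The finitely many smaller heads
  are handled slice by slice.\<close>

lemma dickson_nat_lists:
  fixes A :: "nat list set"
  assumes "\<forall>a\<in>A. length a = n"
  shows "\<exists>F. finite F \<and> F \<subseteq> A \<and> (\<forall>a\<in>A. \<exists>f\<in>F. list_all2 (\<le>) f a)"
  using assms
proof (induction n arbitrary: A)
  case 0
  then have "A \<subseteq> {[]}" by auto
  then have "finite A" by (rule finite_subset) simp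
  then show ?case by (intro exI[of _ A]) (auto intro!: bexI list_all2_refl)
next
  case (Suc n)
  have "\<forall>t\<in>tl ` A. length t = n" using Suc.prems by auto
  from Suc.IH[OF this] obtain T where T: "finite T" "T \<subseteq> tl ` A"
    "\<forall>t\<in>tl ` A. \<exists>f\<in>T. list_all2 (\<le>) f t" by blast
  from finite_subset_image[OF T(1,2)] obtain F0 where F0: "F0 \<subseteq> A" "finite F0" "T = tl ` F0"
    by blast
  \<comment> \<open>Inserting 0 keeps \<open>Max\<close> meaningful when \<open>F0\<close> is
    empty.\<close>
  define M where "M = Max (insert 0 (hd ` F0))"
  have M: "hd f \<le> M" if "f \<in> F0" for f
    unfolding M_def using that F0(2) by (intro Max_ge) auto
  \<comment> \<open>The slice with fixed head \<open>k\<close>, stripped of that head, has vectors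
    of length \<open>n\<close>.\<close>
  have "\<exists>F. finite F \<and> F \<subseteq> {t. k # t \<in> A} \<and> (\<forall>a\<in>{t. k # t \<in> A}. \<exists>f\<in>F. list_all2 (\<le>) f a)" for k
    by (rule Suc.IH) (use Suc.prems in force)
  then obtain G where G: "\<And>k. finite (G k)" "\<And>k. G k \<subseteq> {t. k # t \<in> A}"
    "\<And>k a. k # a \<in> A \<Longrightarrow> \<exists>f\<in>G k. list_all2 (\<le>) f a"
    unfolding mem_Collect_eq Ball_def by metis
  define F where "F = F0 \<union> (\<Union>k<M. (#) k ` G k)"
  show ?case
  proof (intro exI[of _ F] conjI ballI)
    show "finite F" unfolding F_def using F0(2) G(1) by auto
    show "F \<subseteq> A" unfolding F_def using F0(1) G(2) by auto
    fix a assume a: "a \<in> A"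
    then obtain k t where kt: "a = k # t" using Suc.prems by (cases a) auto
    show "\<exists>f\<in>F. list_all2 (\<le>) f a"
    proof (cases "k < M")
      case True
      from G(3) a kt obtain f where "f \<in> G k" "list_all2 (\<le>) f t" by blast
      with True kt show ?thesis by (intro bexI[of _ "k # f"]) (auto simp: F_def)
    next
      case False
      from T(3) a F0(3) obtain f where f: "f \<in> F0" "list_all2 (\<le>) (tl f) (tl a)" by auto
      then have "f \<noteq> []" using F0(1) Suc.prems by fastforce
      with f False kt M[OF f(1)] have "list_all2 (\<le>) f a" by (cases f) auto
      with f(1) show ?thesis by (auto simp: F_def)
    qed
  qed
qed

section \<open>Gap vectors by recursion\<close>

fun inc_hd :: "nat \<Rightarrow> nat list \<Rightarrow> nat list" where
  "inc_hd d [] = []"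
| "inc_hd d (h # t) = (h + d) # t"

text \<open>A structural form of \<open>gap_vector\<close> for an arbitrary predicate, so that
  deletion and relabelling of entries can be treated by list induction instead of arithmetic on
  positions.\<close>

fun gaps :: "('a \<Rightarrow> bool) \<Rightarrow> 'a list \<Rightarrow> nat list" where
  "gaps P [] = [0]"
| "gaps P (x # xs) = (if P x then 0 # gaps P xs else inc_hd 1 (gaps P xs))"

lemma inc_hd_eq_Nil_iff [simp]: "inc_hd d xs = [] \<longleftrightarrow> xs = []"
  by (cases xs) auto

lemma gaps_nonempty [simp]: "gaps P xs \<noteq> []"
  by (induction xs) auto

lemma inc_hd_zero [simp]: "inc_hd 0 xs = xs"
  by (cases xs) auto

lemma inc_hd_inc_hd: "inc_hd d (inc_hd e xs) = inc_hd (d + e) xs"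
  by (cases xs) auto

lemma sum_list_inc_hd: "xs \<noteq> [] \<Longrightarrow> sum_list (inc_hd d xs) = sum_list xs + d"
  by (cases xs) auto

lemma length_filter_plus_gaps: "length (filter P xs) + sum_list (gaps P xs) = length xs"
  by (induction xs) (auto simp: sum_list_inc_hd)

lemma gaps_map_cong:
  "(\<And>x. x \<in> set xs \<Longrightarrow> Q (f x) \<longleftrightarrow> P x) \<Longrightarrow> gaps Q (map f xs) = gaps P xs"
  by (induction xs) auto

text \<open>Generalised for the induction: \<open>k\<close> is the position of the first entry of
  \<open>xs\<close>, and \<open>a\<close> is the last selected position before it or the sentinel.
  The \<open>k - a - 1\<close> entries passed since \<open>a\<close> belong to the first gap. The
  case \<open>a = 0\<close>, \<open>k = 1\<close> is \<open>gap_vector\<close>.\<close>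

lemma position_differences_eq_gaps:
  assumes "a < k"
  shows "map2 (\<lambda>a b. b - a - 1) (a # filter (\<lambda>i. P (xs ! (i - k))) [k..<k + length xs])
           (filter (\<lambda>i. P (xs ! (i - k))) [k..<k + length xs] @ [k + length xs])
         = inc_hd (k - a - 1) (gaps P xs)"
  using assms
proof (induction xs arbitrary: a k)
  case Nil
  then show ?case by simp
next
  case (Cons x xs)
  have shift: "filter (\<lambda>i. P ((x # xs) ! (i - k))) [Suc k..<Suc (k + length xs)]
      = filter (\<lambda>i. P (xs ! (i - Suc k))) [Suc k..<Suc (k + length xs)]"
    by (rule filter_cong) (auto simp: nth_Cons' simp del: upt_Suc)
  have upt: "[k..<k + length (x # xs)] = k # [Suc k..<Suc (k + length xs)]"
    by (simp add: upt_rec[of k] del: upt_Suc)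
  show ?case
  proof (cases "P x")
    case True
    then show ?thesis
      using Cons.IH[of k "Suc k"] unfolding upt by (simp add: shift del: upt_Suc)
  next
    case False
    have "Suc (k - Suc a) = k - a" using Cons.prems by simp
    then show ?thesis
      using Cons.IH[of a "Suc k"] Cons.prems False unfolding upt
      by (simp add: shift inc_hd_inc_hd del: upt_Suc)
  qed
qed

lemma gap_vector_eq_gaps: "gap_vector l \<sigma> = gaps (\<lambda>x. x \<in> {1..l}) \<sigma>"
  using position_differences_eq_gaps[of 0 1 "\<lambda>x. x \<in> {1..l}" \<sigma>]
  unfolding gap_vector_def downfix_positions_def by (simp add: add.commute)

text \<open>Entries satisfying \<open>P\<close> are always kept. Any other entry is dropped if the
  rest of the list can already supply the requested first gap, and kept otherwise.\<close>

lemma exists_subseq_with_gaps: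
  assumes "list_all2 (\<le>) g (gaps P xs)"
  shows "\<exists>ys. subseq ys xs \<and> filter P ys = filter P xs \<and> gaps P ys = g"
  using assms
proof (induction xs arbitrary: g)
  case Nil
  then show ?case by (auto simp: list_all2_Cons2)
next
  case (Cons x xs)
  show ?case
  proof (cases "P x")
    case True
    with Cons.prems obtain g' where g: "g = 0 # g'" "list_all2 (\<le>) g' (gaps P xs)"
      by (auto simp: list_all2_Cons2)
    from Cons.IH[OF g(2)] obtain ys where
      "subseq ys xs" "filter P ys = filter P xs" "gaps P ys = g'" by blast
    with True g(1) show ?thesis by (intro exI[of _ "x # ys"]) auto
  next
    case False
    obtain h t where ht: "gaps P xs = h # t" by (cases "gaps P xs") auto
    from Cons.prems False ht obtain h' t' where g: "g = h' # t'" "h' \<le> Suc h" "list_all2 (\<le>) t' t"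
      by (auto simp: list_all2_Cons2)
    show ?thesis
    proof (cases "h' \<le> h")
      case True
      with g ht have "list_all2 (\<le>) g (gaps P xs)" by simp
      from Cons.IH[OF this] False show ?thesis by (auto intro: list_emb_Cons)
    next
      case h': False
      \<comment> \<open>Here \<open>h' = Suc h\<close>: the rest supplies its full first gap
        \<open>h\<close>, and \<open>x\<close> the missing unit.\<close>
      from g ht have "list_all2 (\<le>) (h # t') (gaps P xs)" by simp
      from Cons.IH[OF this] obtain ys where
        "subseq ys xs" "filter P ys = filter P xs" "gaps P ys = h # t'" by blast
      with False g h' show ?thesis by (intro exI[of _ "x # ys"]) auto
    qed
  qed
qed

section \<open>Reduction\<close>

lemma strict_mono_on_rank:
  fixes S :: "nat set"
  assumes "finite S"
  shows "strict_mono_on S (\<lambda>x. card {y \<in> S. y \<le> x})"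
proof (rule strict_mono_onI)
  fix r s assume "r \<in> S" "s \<in> S" "r < s"
  then have "{y \<in> S. y \<le> r} \<subset> {y \<in> S. y \<le> s}" by force
  then show "card {y \<in> S. y \<le> r} < card {y \<in> S. y \<le> s}"
    using assms by (intro psubset_card_mono) auto
qed

text \<open>Ranks depend only on comparisons within the list, which \<open>f\<close>
  preserves.\<close>

lemma reduction_map_strict_mono:
  assumes "strict_mono_on (set xs) f"
  shows "reduction (map f xs) = reduction xs"
proof -
  have "card {y \<in> f ` set xs. y \<le> f x} = card {y \<in> set xs. y \<le> x}" if x: "x \<in> set xs" for x
  proof -
    have "{y \<in> f ` set xs. y \<le> f x} = f ` {y \<in> set xs. y \<le> x}"
      using assms x by (auto simp: strict_mono_on_less_eq)
    moreover have "inj_on f {y \<in> set xs. y \<le> x}"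
      using strict_mono_on_imp_inj_on[OF assms] by (rule inj_on_subset) auto
    ultimately show ?thesis by (simp add: card_image)
  qed
  then show ?thesis unfolding reduction_def by simp
qed

lemma reduction_eq_map_strict_mono:
  obtains f where "reduction xs = map f xs" "strict_mono_on (set xs) f"
  using that[OF _ strict_mono_on_rank[of "set xs"]] by (simp add: reduction_def)

text \<open>Ranks are injective on the entries and lie in \<open>{1..length xs}\<close>, so by
  counting they fill it.\<close>

lemma is_permutation_reduction:
  assumes "distinct xs"
  shows "reduction xs \<in> permutations_of_set {1..length xs}"
proof -
  let ?f = "\<lambda>x. card {y \<in> set xs. y \<le> x}"
  have inj: "inj_on ?f (set xs)"
    by (rule strict_mono_on_imp_inj_on[OF strict_mono_on_rank]) simp
  have "?f x \<in> {1..length xs}" if "x \<in> set xs" for x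
  proof -
    have "?f x \<le> card (set xs)" by (rule card_mono) auto
    moreover have "0 < ?f x" using that by (subst card_gt_0_iff) auto
    ultimately show ?thesis using card_length[of xs] by simp
  qed
  then have "?f ` set xs \<subseteq> {1..length xs}" by blast
  then have "?f ` set xs = {1..length xs}"
    by (rule card_subset_eq[rotated]) (simp_all add: card_image[OF inj] distinct_card[OF assms])
  then show ?thesis
    using inj assms by (auto simp: reduction_def permutations_of_set_def distinct_map)
qed

text \<open>An occurrence of \<open>p\<close> in the reduction pulls back to the same positions
  \<open>N\<close> of \<open>\<tau>\<close>, hence to an occurrence in
  \<open>\<sigma>\<close>.\<close>

lemma pattern_avoids_reduction_subseq:
  assumes "pattern_avoids \<sigma> p" "subseq \<tau> \<sigma>"
  shows "pattern_avoids (reduction \<tau>) p"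
  unfolding pattern_avoids_def pattern_contains_def
proof safe
  fix xs assume xs: "subseq xs (reduction \<tau>)" "p = reduction xs"
  obtain f where f: "reduction \<tau> = map f \<tau>" "strict_mono_on (set \<tau>) f"
    by (rule reduction_eq_map_strict_mono)
  from xs f obtain N where "xs = nths (map f \<tau>) N" by (auto simp: subseq_conv_nths)
  then have ys: "xs = map f (nths \<tau> N)" by (simp add: nths_map)
  have "strict_mono_on (set (nths \<tau> N)) f"
    using f(2) set_nths_subset by (rule monotone_on_subset)
  then have "reduction (nths \<tau> N) = p" using xs(2) ys by (simp add: reduction_map_strict_mono)
  moreover have "subseq (nths \<tau> N) \<sigma>"
    using assms(2) subseq_conv_nths subseq_order.trans by blast
  ultimately show False using assms(1) by (auto simp: pattern_avoids_def pattern_contains_def)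
qed

text \<open>Reduction fixes the small values because all of \<open>{1..l}\<close> is present and no
  0 shifts their ranks; larger values stay above \<open>l\<close>. This is why reducing does not
  disturb a downfix.\<close>

lemma rank_of_initial_segment:
  fixes S :: "nat set"
  assumes "finite S" "{1..l} \<subseteq> S" "0 \<notin> S" "x \<in> S"
  shows "x \<le> l \<Longrightarrow> card {y \<in> S. y \<le> x} = x" and "l < x \<Longrightarrow> l < card {y \<in> S. y \<le> x}"
proof -
  assume "x \<le> l"
  then have "{y \<in> S. y \<le> x} = {1..x}"
    using assms by (auto simp: Suc_le_eq intro!: gr0I)
  then show "card {y \<in> S. y \<le> x} = x" by simp
next
  assume x: "l < x"
  then have "insert x {1..l} \<subseteq> {y \<in> S. y \<le> x}" using assms by auto
  then have "card (insert x {1..l}) \<le> card {y \<in> S. y \<le> x}"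
    using assms(1) by (intro card_mono) auto
  then show "l < card {y \<in> S. y \<le> x}" using x by simp
qed

section \<open>Monotonicity of emptiness\<close>

text \<open>Infinite sets also have \<open>card\<close> 0, so finiteness is what lets
  \<open>card (Z B \<pi> g) = 0\<close> be read as emptiness.\<close>

lemma finite_Z: "finite (Z B \<pi> g)"
  unfolding Z_def by (rule finite_subset[of _ "permutations_of_set {1..length \<pi> + sum_list g}"]) auto

text \<open>Used contrapositively: emptiness passes from \<open>g\<close> to every larger gap
  vector.\<close>

lemma Z_nonempty_smaller_gaps:
  assumes "\<sigma> \<in> Z B \<pi> g'" "list_all2 (\<le>) g g'"
  shows "Z B \<pi> g \<noteq> {}"
proof -
  define l where "l = length \<pi>"
  define P where "P = (\<lambda>x. x \<in> {1..l})"
  from assms(1) have \<sigma>: "distinct \<sigma>" "set \<sigma> = {1..l + sum_list g'}"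
    "\<forall>p\<in>B. pattern_avoids \<sigma> p" "filter P \<sigma> = \<pi>" "gaps P \<sigma> = g'"
    by (auto simp: Z_def l_def P_def permutations_of_set_def downfix_def gap_vector_eq_gaps)
  from exists_subseq_with_gaps[of g P \<sigma>] assms(2) \<sigma>(5) obtain \<tau> where
    \<tau>: "subseq \<tau> \<sigma>" "filter P \<tau> = filter P \<sigma>" "gaps P \<tau> = g" by auto
  have "distinct \<tau>" using \<tau>(1) \<sigma>(1) by (auto simp: subseq_conv_nths)
  have "set \<tau> \<subseteq> set \<sigma>" using \<tau>(1) by (auto simp: subseq_conv_nths dest: in_set_nthsD)
  then have zero: "0 \<notin> set \<tau>" using \<sigma>(2) by auto
  have len: "length \<tau> = l + sum_list g"
    using length_filter_plus_gaps[of P \<tau>] \<tau>(2,3) \<sigma>(4) by (simp add: l_def)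
  \<comment> \<open>Only entries above \<open>l\<close> were deleted, so the rank lemma applies with
    this \<open>l\<close>.\<close>
  have "{1..l} \<subseteq> set (filter P \<tau>)" unfolding \<tau>(2) using \<sigma>(2) by (auto simp: P_def)
  then have low: "{1..l} \<subseteq> set \<tau>" by auto
  define f where "f = (\<lambda>x. card {y \<in> set \<tau>. y \<le> x})"
  have red: "reduction \<tau> = map f \<tau>" by (simp add: reduction_def f_def)
  have f_low: "f x = x" if "x \<in> set \<tau>" "x \<le> l" for x
    unfolding f_def using rank_of_initial_segment(1)[OF _ low zero] that by simp
  have f_high: "l < f x" if "x \<in> set \<tau>" "l < x" for x
    unfolding f_def using rank_of_initial_segment(2)[OF _ low zero] that by simp
  \<comment> \<open>Since \<open>f\<close> respects the threshold \<open>l\<close>, relabelling by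
    \<open>f\<close> changes neither the positions of the downfix nor the gaps.\<close>
  have P_f: "P (f x) \<longleftrightarrow> P x" if "x \<in> set \<tau>" for x
    using f_low[OF that] f_high[OF that] by (cases "x \<le> l") (auto simp: P_def)
  have "filter P (map f \<tau>) = map f (filter P \<tau>)"
    unfolding filter_map comp_def by (intro arg_cong[of _ _ "map f"] filter_cong) (auto simp: P_f)
  also have "\<dots> = filter P \<tau>" by (rule map_idI) (auto simp: P_def f_low)
  finally have "downfix l (reduction \<tau>) = \<pi>"
    using \<tau>(2) \<sigma>(4) by (simp add: downfix_def red P_def)
  moreover have "gap_vector l (reduction \<tau>) = g"
    unfolding gap_vector_eq_gaps red P_def[symmetric] using gaps_map_cong[where Q = P and f = f and P = P, OF P_f] \<tau>(3) by simp
  moreover have "reduction \<tau> \<in> permutations_of_set {1..l + sum_list g}"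
    using is_permutation_reduction[OF \<open>distinct \<tau>\<close>] len by simp
  moreover have "\<forall>p\<in>B. pattern_avoids (reduction \<tau>) p"
    using \<sigma>(3) pattern_avoids_reduction_subseq \<tau>(1) by blast
  ultimately have "reduction \<tau> \<in> Z B \<pi> g" by (simp add: Z_def l_def)
  then show ?thesis by blast
qed

lemma satisfies_gap_iff: "g \<succeq>\<^sub>g h \<longleftrightarrow> list_all2 (\<le>) h g"
  unfolding satisfies_gap_def by (auto simp: list_all2_conv_all_nth)

theorem mainTheorem1:
  fixes B :: "nat list set" and \<pi> :: "nat list"
  assumes "\<forall>p\<in>B. is_permutation p"
    and "is_permutation \<pi>"
    and "ES_reducible B \<pi>"
  shows "FS_reducible B \<pi>"
proof -
  define n where "n = length \<pi> + 1"
  from assms(3) obtain r where r: "r \<in> {1..length \<pi>}"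
    "\<And>g. length g = n \<Longrightarrow>
        card (Z B \<pi> g) = 0 \<or> card (Z B \<pi> g) = card (Z B (del_perm r \<pi>) (del_gap r g))"
    unfolding ES_reducible_def n_def by blast
  define A where "A = {g. length g = n \<and> Z B \<pi> g = {}}"
  have "\<exists>F. finite F \<and> F \<subseteq> A \<and> (\<forall>a\<in>A. \<exists>f\<in>F. list_all2 (\<le>) f a)"
    by (rule dickson_nat_lists[of _ n]) (simp add: A_def)
  then obtain F where F: "finite F" "F \<subseteq> A" "\<forall>a\<in>A. \<exists>f\<in>F. list_all2 (\<le>) f a" by blast
  from F(1) obtain fs where fs: "set fs = F" using finite_list by blast
  \<comment> \<open>Every vector of length \<open>n\<close> satisfies the final zero condition, so
    it catches exactly those that dominate no generator in \<open>fs\<close>.\<close>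
  define hs where "hs = fs @ [replicate n 0]"
  define rs where "rs = replicate (length fs) 0 @ [r]"
  have count: "card (Z B \<pi> g) =
      (if rs ! i = 0 then 0 else card (Z B (del_perm (rs ! i) \<pi>) (del_gap (rs ! i) g)))"
    if g: "length g = n" and i: "i < length hs" "g \<succeq>\<^sub>g hs ! i" "\<forall>j<i. \<not> g \<succeq>\<^sub>g hs ! j" for g i
  proof (cases "i < length fs")
    case True
    then have "hs ! i \<in> A" using F(2) fs by (auto simp: hs_def nth_append)
    then have "Z B \<pi> g = {}"
      using Z_nonempty_smaller_gaps[of _ B \<pi> g "hs ! i"] i(2) by (auto simp: A_def satisfies_gap_iff)
    with True show ?thesis by (simp add: rs_def nth_append)
  next
    case False
    with i(1) have i_eq: "i = length fs" by (simp add: hs_def)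
    \<comment> \<open>Minimality of \<open>i\<close> excludes all generators; since they generate
      \<open>A\<close>, the set for \<open>g\<close> is nonempty and the second ES alternative must
      hold.\<close>
    have "\<not> list_all2 (\<le>) f g" if "f \<in> F" for f
    proof -
      from that fs obtain j where "j < length fs" "f = fs ! j" by (auto simp: in_set_conv_nth)
      with i(3) i_eq show ?thesis by (auto simp: hs_def nth_append satisfies_gap_iff)
    qed
    with F(3) have "g \<notin> A" by blast
    with g have "card (Z B \<pi> g) \<noteq> 0" using finite_Z by (auto simp: A_def)
    with r(2)[OF g] r(1) show ?thesis by (auto simp: rs_def i_eq nth_append)
  qed
  have "\<forall>h\<in>set hs. length h = length \<pi> + 1" using F(2) fs by (auto simp: hs_def A_def n_def)
  moreover have "set rs \<subseteq> {0..length \<pi>}" using r(1) by (auto simp: rs_def)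
  moreover have "hs \<noteq> []" "length rs = length hs" "last hs = replicate (length \<pi> + 1) 0"
    by (simp_all add: hs_def rs_def n_def)
  ultimately show ?thesis
    unfolding FS_reducible_def using count[unfolded n_def] by blast
qed

end
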